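(* For all complex $p$, $x\neq\pm1$, $t\neq 0$ for which the integral on the right converges (along the straight segment from $0$ to $t$), $$\sum _{n=0}^{\infty } \frac{t^n\, C_n^{\left(p+\frac{1}{2}\right)}(x)}{(n+2 p+1)!}=\int_0^t \frac{2^p s^{2 p} t^{-2 p-1}\, \Gamma (p+1)\, e^{s x} \left(s \sqrt{1-x^2}\right)^{-p} J_p\left(s \sqrt{1-x^2}\right)}{\Gamma (2 p+1)} \, ds .$$
   Context: $C_n^{(\lambda)}(x)$ is the Gegenbauer (ultraspherical) polynomial, $J_p$ is the Bessel function of the first kind, and for complex $w$ one writes $w!=\Gamma(w+1)$. Powers and square roots are principal values (the function $w^{-p}J_p(w)$ is understood as the entire even function of $w$ it defines). *)

theory Defs
  imports "HOL-Complex_Analysis.Complex_Analysis"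
begin

(* The classical explicit form; it gives the coefficients of r^n in
   (1 - 2 * x * r + r^2) powr (-l).  In particular C_0 = 1 for every l,
   including l = 0. *)
definition gegenbauer :: "nat \<Rightarrow> complex \<Rightarrow> complex \<Rightarrow> complex" where
  "gegenbauer n l x =
     (\<Sum>k\<le>n div 2. (- 1) ^ k * pochhammer l (n - k) / (fact k * fact (n - 2 * k))
                    * (2 * x) ^ (n - 2 * k))"

lemma gegenbauer_0 [simp]: "gegenbauer 0 l x = 1"
  by (simp add: gegenbauer_def)

lemma gegenbauer_1: "gegenbauer 1 l x = 2 * l * x"
  by (simp add: gegenbauer_def)

lemma gegenbauer_2: "gegenbauer 2 l x = 2 * l * (l + 1) * x\<^sup>2 - l"
  by (simp add: gegenbauer_def eval_nat_numeral pochhammer_rec algebra_simps)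

definition complex_fact :: "complex \<Rightarrow> complex" where
  "complex_fact w = Gamma (w + 1)"

lemma complex_fact_of_nat: "complex_fact (of_nat n) = fact n"
  by (simp add: complex_fact_def Gamma_fact add.commute)

(* Bessel function of the first kind, principal branch.  The reciprocal Gamma
   function rGamma makes the series correct for negative integer p as well.  The
   case distinction is needed because 0 powr 0 = 0, whereas J_0(0) = 1. *)
definition Bessel_J :: "complex \<Rightarrow> complex \<Rightarrow> complex" where
  "Bessel_J p w =
     (if p = 0 then 1 else (w / 2) powr p) *
     (\<Sum>k. (- 1) ^ k * rGamma (p + of_nat k + 1) / fact k * (w / 2) ^ (2 * k))"

(* w^(-p) * J_p(w) as an entire even function; the value at w = 0 fills the
   removable singularity.  Off 0 the principal branches of the two powers cancel,
   see Bessel_J_entire_altdef, so no branch cut remains. *)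
definition Bessel_J_entire :: "complex \<Rightarrow> complex \<Rightarrow> complex" where
  "Bessel_J_entire p w =
     (if w = 0 then 2 powr (- p) * rGamma (p + 1) else w powr (- p) * Bessel_J p w)"

lemma Bessel_J_entire_altdef:
  "Bessel_J_entire p w =
     2 powr (- p) *
     (\<Sum>k. (- 1) ^ k * rGamma (p + of_nat k + 1) / fact k * (w / 2) ^ (2 * k))"
proof (cases "w = 0")
  case True
  have "(\<Sum>k. (- 1) ^ k * rGamma (p + of_nat k + 1) / fact k * ((w / 2)\<^sup>2) ^ k) = rGamma (p + 1)"
    using powser_zero[of "\<lambda>k. (- 1) ^ k * rGamma (p + of_nat k + 1) / fact k"] True by simp
  then show ?thesis
    using True by (simp add: Bessel_J_entire_def power_mult)
next
  case False
  have "Ln (w / 2) = Ln w - Ln 2"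
    using Ln_divide_of_real[of 2 w] False Ln_of_real[of 2] by simp
  then have "w powr (- p) * (w / 2) powr p = 2 powr (- p)"
    using False by (simp add: powr_def flip: exp_add) (simp add: algebra_simps)
  moreover have "w powr (- p) * (if p = 0 then 1 else (w / 2) powr p) = w powr (- p) * (w / 2) powr p"
    using False by simp
  ultimately show ?thesis
    using False by (simp add: Bessel_J_entire_def Bessel_J_def flip: mult.assoc)
qed

lemma Bessel_J_entire_even: "Bessel_J_entire p (- w) = Bessel_J_entire p w"
  by (simp add: Bessel_J_entire_altdef power_mult)

lemma summable_Bessel_J_series:
  "summable (\<lambda>k. (- 1) ^ k * rGamma (p + of_nat k + 1) / fact k * (z :: complex) ^ k)"
proof -
  define a where "a = (\<lambda>k. (- 1) ^ k * rGamma (p + of_nat k + 1) / fact k * z ^ k)"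
  have step: "of_nat (Suc k) * (p + of_nat k + 1) * a (Suc k) = - z * a k" for k
  proof -
    have "(p + of_nat k + 1) * rGamma (p + of_nat (Suc k) + 1) = rGamma (p + of_nat k + 1)"
      using rGamma_plus1[of "p + of_nat k + 1"] by (simp add: add_ac)
    moreover have "of_nat (Suc k) * (p + of_nat k + 1) * a (Suc k) =
        - ((- 1) ^ k * ((p + of_nat k + 1) * rGamma (p + of_nat (Suc k) + 1)) / fact k * z ^ Suc k)"
      unfolding a_def fact_Suc by (simp add: field_simps del: of_nat_Suc)
    ultimately show ?thesis
      by (simp add: a_def)
  qed
  obtain N where N: "real N \<ge> norm p + 2 * norm z"
    using real_arch_simple by blast
  have "norm (a (Suc k)) \<le> 1 / 2 * norm (a k)" if "k \<ge> N" for k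
  proof -
    have "real k + 1 = norm (of_nat k + 1 :: complex)"
      by (metis norm_of_nat of_nat_1 of_nat_add)
    also have "\<dots> \<le> norm (p + of_nat k + 1) + norm p"
      using norm_triangle_ineq4[of "p + of_nat k + 1" p] by simp
    finally have "2 * norm z \<le> norm (p + of_nat k + 1)"
      using N that by simp
    also have "\<dots> \<le> real (Suc k) * norm (p + of_nat k + 1)"
      by (simp add: mult_le_cancel_right1)
    finally have "2 * norm z * norm (a (Suc k)) \<le> real (Suc k) * norm (p + of_nat k + 1) * norm (a (Suc k))"
      by (rule mult_right_mono) simp
    also have "\<dots> = norm (of_nat (Suc k) * (p + of_nat k + 1) * a (Suc k))"
      by (simp add: norm_mult del: of_nat_Suc)
    also have "\<dots> = norm z * norm (a k)"
      by (simp only: step norm_mult norm_minus_cancel)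
    finally show ?thesis
      by (cases "z = 0") (simp_all add: a_def)
  qed
  then have "summable a"
    by (intro summable_ratio_test[of "1/2" N]) auto
  then show ?thesis
    by (simp add: a_def)
qed

lemma holomorphic_Bessel_J_entire: "Bessel_J_entire p holomorphic_on UNIV"
proof -
  define c where "c = (\<lambda>k. (- 1) ^ k * rGamma (p + of_nat k + 1) / fact k)"
  have "(\<lambda>z. \<Sum>k. c k * z ^ k) holomorphic_on UNIV"
    using termdiffs_strong_converges_everywhere[of c] summable_Bessel_J_series[of p]
    by (auto simp: c_def holomorphic_on_open)
  then have "((\<lambda>z. \<Sum>k. c k * z ^ k) \<circ> (\<lambda>w. (w / 2)\<^sup>2)) holomorphic_on UNIV"
    by (intro holomorphic_on_compose_gen[where t = UNIV] holomorphic_intros) auto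
  then have "(\<lambda>w. 2 powr (- p) * (\<Sum>k. c k * ((w / 2)\<^sup>2) ^ k)) holomorphic_on UNIV"
    by (intro holomorphic_intros) (simp add: o_def)
  then show ?thesis
    by (simp add: Bessel_J_entire_altdef[abs_def] c_def power_mult)
qed

end

theory Submission
  imports Defs
begin

text \<open>
  The starting point is the generating function
  \<open>\<Sum>\<^sub>n C\<^sub>n(x) s\<^sup>n / (2 p + 1)\<^sub>n = \<Gamma>(p + 1) 2\<^sup>p e\<^bsup>x s\<^esup> z\<^sup>-\<^sup>p J\<^sub>p(z)\<close> with \<open>z = s \<surd>(1 - x\<^sup>2)\<close>, where \<open>C\<^sub>n\<close> is the
  Gegenbauer polynomial of parameter \<open>p + 1/2\<close> (lemma \<open>gegenbauer_bessel_generating_function\<close>). It holds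
  because both sides satisfy the same linear differential equation of order two in \<open>s\<close>: for the right
  side this is Bessel's equation conjugated by \<open>e\<^bsup>x s\<^esup>\<close>, and for the left side it is the three-term
  recurrence of the Gegenbauer polynomials.

  The integrand in question is this function times \<open>s\<^bsup>2p\<^esup> t\<^bsup>-2p-1\<^esup> / \<Gamma>(2 p + 1)\<close>. Integrated term by term from
  \<open>0\<close> to \<open>t\<close> it gives \<open>C\<^sub>n(x) t\<^sup>n / ((2 p + 1)\<^sub>n (n + 2 p + 1) \<Gamma>(2 p + 1))\<close>, and the denominator is
  \<open>\<Gamma>(n + 2 p + 2) = (n + 2 p + 1)!\<close>.

  Only the lower end of the integral is delicate, as \<open>p\<close> is an arbitrary complex number for which the
  integral exists. All of them can be treated alike: with \<open>w = 2 p + 1\<close>, the antiderivative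
  equals \<open>u\<^sup>w\<close> times a power series with nonzero constant coefficient, and existence of the integral makes
  it convergent as \<open>u\<close> decreases to \<open>0\<close>. A power \<open>u\<^sup>w\<close> with \<open>w \<noteq> 0\<close> that converges there converges to
  \<open>0\<close> (lemma \<open>tendsto_powr_at_right_0_imp_0\<close>), so the lower end contributes nothing (lemma
  \<open>sums_integral_powr_times_power_series\<close>).
\<close>

section \<open>The three-term recurrence of the Gegenbauer polynomials\<close>

text \<open>
  Extending the \<open>k\<close>-th summand of the explicit form by \<open>0\<close> beyond \<open>n div 2\<close> lets the sums for three
  consecutive degrees run over a common range, so that the three-term recurrence can be checked
  summand by summand.
\<close>
definition gegenbauer_term :: "complex \<Rightarrow> complex \<Rightarrow> nat \<Rightarrow> nat \<Rightarrow> complex" where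
  "gegenbauer_term l x n k =
     (if 2 * k \<le> n
      then (- 1) ^ k * pochhammer l (n - k) / (fact k * fact (n - 2 * k)) * (2 * x) ^ (n - 2 * k)
      else 0)"

lemma gegenbauer_eq_sum_terms:
  assumes "n div 2 \<le> M"
  shows "gegenbauer n l x = (\<Sum>k\<le>M. gegenbauer_term l x n k)"
proof -
  have "gegenbauer n l x = (\<Sum>k\<le>n div 2. gegenbauer_term l x n k)"
    unfolding gegenbauer_def by (intro sum.cong) (auto simp: gegenbauer_term_def)
  also have "\<dots> = (\<Sum>k\<le>M. gegenbauer_term l x n k)"
    using assms by (intro sum.mono_neutral_left) (auto simp: gegenbauer_term_def)
  finally show ?thesis .
qed

lemma gegenbauer_term_rec_0:
  "of_nat (n + 2) * gegenbauer_term l x (n + 2) 0 =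
     2 * x * (of_nat (n + 1) + l) * gegenbauer_term l x (n + 1) 0"
  by (simp add: gegenbauer_term_def pochhammer_Suc field_simps del: of_nat_Suc)

text \<open>
  In the recurrence the summands of degrees \<open>n + 2\<close> and \<open>n + 1\<close> with index \<open>k + 1\<close> go with the summand
  of degree \<open>n\<close> with index \<open>k\<close>: these are the ones carrying the same power of \<open>x\<close> once the factor
  \<open>2 * x\<close> is taken into account. After removal of the common factor the claim is a polynomial
  identity.
\<close>
lemma gegenbauer_term_rec_Suc:
  "of_nat (n + 2) * gegenbauer_term l x (n + 2) (Suc k) =
     2 * x * (of_nat (n + 1) + l) * gegenbauer_term l x (n + 1) (Suc k)
     - (of_nat n + 2 * l) * gegenbauer_term l x n k"
proof (cases "2 * k \<le> n")
  case True
  then obtain N where n: "n = 2 * k + N"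
    using le_Suc_ex by blast
  have sub: "2 * k + N + 2 - Suc k = Suc (k + N)" "2 * k + N + 1 - Suc k = k + N" "2 * k + N - k = k + N"
     "2 * k + N + 2 - 2 * Suc k = N" "2 * k + N - 2 * k = N"
    by auto
  show ?thesis
  proof (cases N)
    case 0
    define A where "A = (- 1) ^ k * pochhammer l k / fact k"
    define K where "K = (of_nat (Suc k) :: complex)"
    have "K \<noteq> 0"
      by (simp add: K_def del: of_nat_Suc)
    have "gegenbauer_term l x (n + 2) (Suc k) =
        - ((- 1) ^ k * pochhammer l k * (l + of_nat k) / (of_nat (Suc k) * fact k))"
      unfolding gegenbauer_term_def n sub pochhammer_Suc using 0 by (simp add: pochhammer_Suc mult_ac)
    then have "gegenbauer_term l x (n + 2) (Suc k) = - (A * (l + K - 1) / K)"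
      by (simp add: A_def K_def)
    moreover have "gegenbauer_term l x (n + 1) (Suc k) = 0"
      by (simp add: gegenbauer_term_def n 0)
    moreover have "gegenbauer_term l x n k = A"
      unfolding gegenbauer_term_def n sub A_def using 0 by simp
    moreover have "of_nat (n + 2) = 2 * K" "of_nat n = 2 * K - 2"
      by (simp_all add: n 0 K_def)
    ultimately show ?thesis
      using \<open>K \<noteq> 0\<close> by (simp only:) (simp add: field_simps)
  next
    case (Suc M)
    have T2: "gegenbauer_term l x (n + 2) (Suc k) =
        - ((- 1) ^ k * pochhammer l (k + N) * (l + of_nat (k + N)) / (of_nat (Suc k) * fact k * (of_nat (Suc M) * fact M)) * (2 * x) ^ Suc M)"
      unfolding gegenbauer_term_def n sub pochhammer_Suc using Suc by (simp add: mult_ac)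
    have T1: "gegenbauer_term l x (n + 1) (Suc k) =
        - ((- 1) ^ k * pochhammer l (k + N) / (of_nat (Suc k) * fact k * fact M) * (2 * x) ^ M)"
    proof -
      have "2 * k + N + 1 - 2 * Suc k = M" using Suc by simp
      then show ?thesis
        unfolding gegenbauer_term_def n sub using Suc by (simp add: mult_ac)
    qed
    have T0: "gegenbauer_term l x n k =
        (- 1) ^ k * pochhammer l (k + N) / (fact k * (of_nat (Suc M) * fact M)) * (2 * x) ^ Suc M"
      unfolding gegenbauer_term_def n sub using Suc by (simp add: mult_ac)
    \<comment> \<open>\<open>A\<close> is the common factor; the remaining identity contains the indices only through \<open>k + 1\<close> and \<open>N\<close>.\<close>
    define A where "A = (- 1) ^ k * pochhammer l (k + N) / (fact k * fact M) * (2 * x) ^ M"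
    define K M' where "K = (of_nat (Suc k) :: complex)" and "M' = (of_nat (Suc M) :: complex)"
    have nz: "K \<noteq> 0" "M' \<noteq> 0"
      by (simp_all add: K_def M'_def del: of_nat_Suc)
    have "gegenbauer_term l x (n + 2) (Suc k) = - (A * (l + K + M' - 1) / (K * M') * (2 * x))"
      unfolding T2 by (simp add: A_def K_def M'_def Suc mult_ac add_ac)
    moreover have "gegenbauer_term l x (n + 1) (Suc k) = - (A / K)"
      unfolding T1 by (simp add: A_def K_def mult_ac)
    moreover have "gegenbauer_term l x n k = A / M' * (2 * x)"
      unfolding T0 by (simp add: A_def M'_def mult_ac)
    moreover have "of_nat (n + 2) = 2 * K + M'" "of_nat (n + 1) = 2 * K + M' - 1" "of_nat n = 2 * K + M' - 2"
      by (simp_all add: n Suc K_def M'_def)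
    ultimately show ?thesis
      using nz by (simp only:) (simp add: field_simps)
  qed
qed (simp add: gegenbauer_term_def)

lemma gegenbauer_recurrence:
  "of_nat (n + 2) * gegenbauer (n + 2) l x =
     2 * x * (of_nat (n + 1) + l) * gegenbauer (n + 1) l x - (of_nat n + 2 * l) * gegenbauer n l x"
proof -
  have "of_nat (n + 2) * gegenbauer (n + 2) l x =
      (\<Sum>k\<le>Suc n. of_nat (n + 2) * gegenbauer_term l x (n + 2) k)"
    by (subst gegenbauer_eq_sum_terms[of _ "Suc n"]) (simp_all add: sum_distrib_left del: sum.atMost_Suc of_nat_add)
  also have "\<dots> = 2 * x * (of_nat (n + 1) + l) * (\<Sum>k\<le>Suc n. gegenbauer_term l x (n + 1) k)
       - (of_nat n + 2 * l) * (\<Sum>k\<le>n. gegenbauer_term l x n k)"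
    unfolding sum.atMost_Suc_shift gegenbauer_term_rec_0 gegenbauer_term_rec_Suc
    by (simp add: sum_subtractf sum_distrib_left distrib_left del: of_nat_add)
  also have "(\<Sum>k\<le>Suc n. gegenbauer_term l x (n + 1) k) = gegenbauer (n + 1) l x"
    by (subst gegenbauer_eq_sum_terms[of _ "Suc n"]) auto
  also have "(\<Sum>k\<le>n. gegenbauer_term l x n k) = gegenbauer n l x"
    by (subst gegenbauer_eq_sum_terms[of _ n]) auto
  finally show ?thesis .
qed

section \<open>The generating function with a Bessel factor\<close>

text \<open>
  The power series of \<open>\<Gamma>(p + 1) (w / 2)\<^sup>-\<^sup>p J\<^sub>p(w)\<close> in \<open>s\<close>, where \<open>w = s \<surd>b\<close>. Only \<open>b\<close> itself enters, so no
  square root is chosen, and the normalisation makes the constant coefficient \<open>1\<close>.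
\<close>
definition bessel_fps :: "complex \<Rightarrow> complex \<Rightarrow> complex fps" where
  "bessel_fps p b =
     Abs_fps (\<lambda>n. if even n
       then (- b / 4) ^ (n div 2) / (fact (n div 2) * pochhammer (p + 1) (n div 2)) else 0)"

text \<open>
  Bessel's equation, rewritten for the entire factor \<open>w\<^sup>-\<^sup>p J\<^sub>p(w)\<close>.
\<close>
lemma bessel_fps_ode:
  assumes "p + 1 \<notin> \<int>\<^sub>\<le>\<^sub>0"
  shows "fps_X * fps_deriv (fps_deriv (bessel_fps p b)) + fps_const (2 * p + 1) * fps_deriv (bessel_fps p b)
           + fps_const b * (fps_X * bessel_fps p b) = 0"
proof (rule fps_ext)
  fix n
  show "fps_nth (fps_X * fps_deriv (fps_deriv (bessel_fps p b)) + fps_const (2 * p + 1) * fps_deriv (bessel_fps p b)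
           + fps_const b * (fps_X * bessel_fps p b)) n = fps_nth 0 n"
  proof (cases "odd n")
    case True
    then obtain m where n: "n = 2 * m + 1"
      by (auto elim: oddE)
    have half: "Suc (Suc (2 * m)) div 2 = Suc m" by simp
    have nz: "pochhammer (p + 1) m \<noteq> 0" "p + 1 + of_nat m \<noteq> 0"
      using assms pochhammer_eq_0_imp_nonpos_Int plus_of_nat_eq_0_imp by blast+
    define A where "A = (- b / 4) ^ m / (fact m * pochhammer (p + 1) m)"
    define c where "c = bessel_fps p b"
    define M where "M = (of_nat m + 1 :: complex)"
    have M: "M \<noteq> 0" "p + M \<noteq> 0" 
      using nz(2) of_nat_neq_0[of m, where 'a = complex] by (auto simp: M_def add_ac)
    have c0: "fps_nth c (2 * m) = A"
      by (simp add: c_def bessel_fps_def A_def)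
    have c2': "fps_nth c (Suc (Suc (2 * m))) = A * (- b / 4) / (M * (p + M))"
      by (simp add: c_def bessel_fps_def A_def M_def pochhammer_Suc add_ac mult_ac)
    have "4 * M * (p + M) * (A * (- b / 4) / (M * (p + M))) = - b * A * (M * (p + M)) / (M * (p + M))"
      by simp
    then have c2: "4 * M * (p + M) * fps_nth c (Suc (Suc (2 * m))) = - b * A"
      unfolding c2' using M by simp
    have "fps_nth (fps_X * fps_deriv (fps_deriv c) + fps_const (2 * p + 1) * fps_deriv c
           + fps_const b * (fps_X * c)) n = 4 * M * (p + M) * fps_nth c (Suc (Suc (2 * m))) + b * fps_nth c (2 * m)"
      by (simp add: n M_def algebra_simps)
    then show ?thesis
      unfolding c0 c2 by (simp add: c_def)
  next
    case False
    then show ?thesis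
      by (cases n) (auto simp: bessel_fps_def)
  qed
qed

text \<open>
  A pole of \<open>\<Gamma>(p + 1)\<close> would be one of \<open>\<Gamma>(2 p + 1)\<close>, since \<open>2 p + 1 = 2 (p + 1) - 1\<close>.
\<close>
lemma plus_1_notin_nonpos_Ints:
  fixes p :: complex
  assumes "2 * p + 1 \<notin> \<int>\<^sub>\<le>\<^sub>0"
  shows "p + 1 \<notin> \<int>\<^sub>\<le>\<^sub>0"
proof
  assume "p + 1 \<in> \<int>\<^sub>\<le>\<^sub>0"
  then have "of_nat 2 * (p + 1) \<in> \<int>\<^sub>\<le>\<^sub>0"
    by (intro Nats_mult_nonpos_Ints) auto
  also have "of_nat 2 * (p + 1) = (2 * p + 1) + 1"
    by simp
  finally show False
    using assms plus_one_in_nonpos_Ints_imp by blast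
qed

text \<open>
  Multiplication by \<open>e\<^bsup>x s\<^esup>\<close> turns the equation \<open>s g'' + (2 p + 1) g' + (1 - x\<^sup>2) s g = 0\<close> of the Bessel
  factor into \<open>s y'' + (2 p + 1) y' - 2 x s y' - (2 p + 1) x y + s y = 0\<close>: the terms with \<open>x\<^sup>2\<close> cancel,
  which is why the argument \<open>s \<surd>(1 - x\<^sup>2)\<close> is the right one. Read off coefficientwise, this is the
  three-term recurrence of the Gegenbauer polynomials divided by \<open>(2 p + 1)\<^sub>n\<close>, so equality for
  \<open>n = 0\<close> and \<open>n = 1\<close> suffices.
\<close>
lemma fps_nth_exp_times_bessel:
  assumes "2 * p + 1 \<notin> \<int>\<^sub>\<le>\<^sub>0"
  shows "fps_nth (fps_exp x * bessel_fps p (1 - x\<^sup>2)) n =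
           gegenbauer n (p + 1 / 2) x / pochhammer (2 * p + 1) n"
proof -
  have p: "p + 1 \<notin> \<int>\<^sub>\<le>\<^sub>0"
    using assms by (rule plus_1_notin_nonpos_Ints)
  define Y where "Y = fps_exp x * bessel_fps p (1 - x\<^sup>2)"
  define G where "G = bessel_fps p (1 - x\<^sup>2)"
  define w where "w = 2 * p + 1"
  have "fps_X * fps_deriv (fps_deriv Y) + fps_const w * fps_deriv Y - 2 * fps_const x * (fps_X * fps_deriv Y)
          - fps_const w * fps_const x * Y + fps_X * Y =
        fps_exp x * (fps_X * fps_deriv (fps_deriv G) + fps_const w * fps_deriv G
          + (1 - fps_const x ^ 2) * (fps_X * G))"
    unfolding Y_def G_def[symmetric] by (simp add: algebra_simps power2_eq_square del: fps_const_mult fps_const_power)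
  also have "1 - fps_const x ^ 2 = fps_const (1 - x\<^sup>2)"
    by (simp add: fps_const_power flip: fps_const_sub)
  also have "fps_X * fps_deriv (fps_deriv G) + fps_const w * fps_deriv G + fps_const (1 - x\<^sup>2) * (fps_X * G) = 0"
    unfolding G_def w_def by (rule bessel_fps_ode[OF p])
  finally have ode: "fps_X * fps_deriv (fps_deriv Y) + fps_const w * fps_deriv Y - 2 * fps_const x * (fps_X * fps_deriv Y)
          - fps_const w * fps_const x * Y + fps_X * Y = 0"
    by simp
  have rec: "of_nat (n + 2) * (of_nat (n + 1) + w) * fps_nth Y (n + 2) =
      x * (2 * of_nat (n + 1) + w) * fps_nth Y (n + 1) - fps_nth Y n" for n
  proof -
    have "fps_nth (fps_X * fps_deriv (fps_deriv Y) + fps_const w * fps_deriv Y - 2 * fps_const x * (fps_X * fps_deriv Y)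
          - fps_const w * fps_const x * Y + fps_X * Y) (Suc n) = 0"
      unfolding ode by simp
    then show ?thesis
      by (simp add: algebra_simps numeral_fps_const)
  qed
  have w: "w + of_nat n \<noteq> 0" "pochhammer w n \<noteq> 0" for n
    using assms pochhammer_eq_0_imp_nonpos_Int plus_of_nat_eq_0_imp unfolding w_def by blast+
  have Y0: "fps_nth Y 0 = 1" "fps_nth Y 1 = x"
    by (simp_all add: Y_def bessel_fps_def fps_mult_nth)
  have "fps_nth Y n = gegenbauer n (p + 1 / 2) x / pochhammer w n"
  proof (induction n rule: less_induct)
    case (less n)
    consider "n = 0" | "n = 1" | k where "n = k + 2"
      by (metis add_2_eq_Suc' not0_implies_Suc One_nat_def)
    then show ?case
    proof cases
      case 1
      then show ?thesis using Y0 by simp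
    next
      case 2
      have "2 * (p + 1 / 2) = w" by (simp add: w_def)
      then show ?thesis
        using 2 Y0 w(1)[of 0] gegenbauer_1[of "p + 1 / 2" x] by (simp only:) simp
    next
      case 3
      define C where "C = (\<lambda>k. gegenbauer k (p + 1 / 2) x)"
      define P where "P = pochhammer w k"
      define K where "K = (of_nat k :: complex)"
      have nz: "P \<noteq> 0" "w + K \<noteq> 0" "w + K + 1 \<noteq> 0" "K + 2 \<noteq> 0"
        using w(2)[of k] w(1)[of k] w(1)[of "Suc k"] of_nat_neq_0[of "Suc k", where 'a = complex]
        by (auto simp: P_def K_def add_ac)
      have IH: "fps_nth Y (k + 1) = C (k + 1) / (P * (w + K))" "fps_nth Y k = C k / P"
        using less[of "k + 1"] less[of k] 3 by (simp_all add: C_def P_def K_def pochhammer_Suc)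
      have Crec: "(K + 2) * C (k + 2) = x * (2 * K + 2 + w) * C (k + 1) - (K + w) * C k"
        using gegenbauer_recurrence[of k "p + 1 / 2" x] by (simp add: C_def K_def w_def algebra_simps)
      have "(K + 2) * (K + 1 + w) * fps_nth Y (k + 2) =
          x * (2 * K + 2 + w) * (C (k + 1) / (P * (w + K))) - C k / P"
        using rec[of k] unfolding IH by (simp add: K_def algebra_simps)
      also have "\<dots> = (x * (2 * K + 2 + w) * C (k + 1) - (K + w) * C k) / (P * (w + K))"
        using nz by (simp add: diff_divide_distrib add.commute)
      also have "\<dots> = (K + 2) * (K + 1 + w) * (C (k + 2) / (P * (w + K) * (w + K + 1)))"
        unfolding Crec[symmetric] using nz by (simp add: divide_simps add_ac)
      finally have "(K + 2) * (K + 1 + w) * fps_nth Y (k + 2) =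
          (K + 2) * (K + 1 + w) * (C (k + 2) / (P * (w + K) * (w + K + 1)))" .
      moreover have "(K + 2) * (K + 1 + w) \<noteq> 0"
        using nz by (simp add: add_ac)
      ultimately have "fps_nth Y (k + 2) = C (k + 2) / (P * (w + K) * (w + K + 1))"
        using mult_left_cancel by metis
      then show ?thesis
        using 3 by (simp add: C_def P_def K_def pochhammer_Suc add_ac)
    qed
  qed
  then show ?thesis by (simp add: Y_def w_def)
qed

text \<open>
  The quotient \<open>\<Gamma>(p + 1) / \<Gamma>(p + k + 1)\<close> is \<open>1 / (p + 1)\<^sub>k\<close>, and the Bessel series has only the even
  powers of \<open>z\<close>, so the two series agree after reindexing.
\<close>
lemma sums_bessel_fps:
  assumes p: "p + 1 \<notin> \<int>\<^sub>\<le>\<^sub>0"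
  shows "(\<lambda>n. fps_nth (bessel_fps p (w\<^sup>2)) n * z ^ n) sums
           (2 powr p * Gamma (p + 1) * Bessel_J_entire p (z * w))"
proof -
  define a where "a = (\<lambda>k. (- 1) ^ k * rGamma (p + of_nat k + 1) / fact k * ((z * w / 2)\<^sup>2) ^ k)"
  have "(\<lambda>k. Gamma (p + 1) * a k) sums (Gamma (p + 1) * suminf a)"
    unfolding a_def by (intro sums_mult summable_sums summable_Bessel_J_series)
  also have "(\<lambda>k. Gamma (p + 1) * a k) = (\<lambda>k. fps_nth (bessel_fps p (w\<^sup>2)) (2 * k) * z ^ (2 * k))"
  proof
    fix k
    have inv: "Gamma (p + 1) * rGamma (p + of_nat k + 1) = 1 / pochhammer (p + 1) k"
      using pochhammer_Gamma[OF p, of k] by (simp add: rGamma_inverse_Gamma add_ac divide_inverse)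
    have "Gamma (p + 1) * a k =
        (- 1) ^ k * (Gamma (p + 1) * rGamma (p + of_nat k + 1)) / fact k * ((z * w / 2)\<^sup>2) ^ k"
      by (simp add: a_def mult_ac)
    also have "\<dots> = (- 1) ^ k * (1 / pochhammer (p + 1) k) / fact k * ((z * w / 2)\<^sup>2) ^ k"
      unfolding inv ..
    also have "\<dots> = (- (w\<^sup>2) / 4) ^ k / (fact k * pochhammer (p + 1) k) * z ^ (2 * k)"
      unfolding power_mult[of z]
      by (simp add: power_divide power_mult_distrib power_minus[of "w\<^sup>2 / 4"] mult_ac)
    finally show "Gamma (p + 1) * a k = fps_nth (bessel_fps p (w\<^sup>2)) (2 * k) * z ^ (2 * k)"
      by (simp add: bessel_fps_def)
  qed
  also have "\<dots> sums (Gamma (p + 1) * suminf a) \<longleftrightarrow>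
      (\<lambda>n. fps_nth (bessel_fps p (w\<^sup>2)) n * z ^ n) sums (Gamma (p + 1) * suminf a)"
    by (rule sums_mono_reindex[where f = "\<lambda>n. fps_nth (bessel_fps p (w\<^sup>2)) n * z ^ n"])
       (auto simp: strict_mono_def bessel_fps_def elim!: evenE)
  also have "Gamma (p + 1) * suminf a = 2 powr p * Gamma (p + 1) * Bessel_J_entire p (z * w)"
    by (simp add: Bessel_J_entire_altdef a_def power_mult powr_minus)
  finally show ?thesis .
qed

lemma fps_conv_radius_bessel_fps:
  assumes "p + 1 \<notin> \<int>\<^sub>\<le>\<^sub>0"
  shows "fps_conv_radius (bessel_fps p b) = \<infinity>"
  unfolding fps_conv_radius_def
  by (rule conv_radius_inftyI'')
     (use sums_bessel_fps[OF assms, of "csqrt b"] in \<open>auto simp: sums_iff\<close>)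

text \<open>
  The classical exponential-type generating function of the Gegenbauer polynomials with parameter
  \<open>p + 1/2\<close>.
\<close>
lemma gegenbauer_bessel_generating_function:
  assumes "2 * p + 1 \<notin> \<int>\<^sub>\<le>\<^sub>0"
  shows "(\<lambda>n. gegenbauer n (p + 1 / 2) x / pochhammer (2 * p + 1) n * s ^ n) sums
           (2 powr p * Gamma (p + 1) * exp (s * x) * Bessel_J_entire p (s * csqrt (1 - x\<^sup>2)))"
proof -
  note p = plus_1_notin_nonpos_Ints[OF assms]
  define Y where "Y = fps_exp x * bessel_fps p (1 - x\<^sup>2)"
  have "fps_conv_radius Y = \<infinity>"
    using fps_conv_radius_mult[of "fps_exp x" "bessel_fps p (1 - x\<^sup>2)"]
    by (simp add: Y_def fps_conv_radius_bessel_fps[OF p])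
  then have "(\<lambda>n. fps_nth Y n * s ^ n) sums eval_fps Y s"
    by (intro sums_eval_fps) simp
  also have "eval_fps Y s = exp (x * s) * eval_fps (bessel_fps p (1 - x\<^sup>2)) s"
    unfolding Y_def by (subst eval_fps_mult) (simp_all add: fps_conv_radius_bessel_fps[OF p])
  also have "eval_fps (bessel_fps p (1 - x\<^sup>2)) s = 2 powr p * Gamma (p + 1) * Bessel_J_entire p (s * csqrt (1 - x\<^sup>2))"
    using sums_bessel_fps[OF p, of "csqrt (1 - x\<^sup>2)" s] by (simp add: eval_fps_def sums_iff)
  finally show ?thesis
    by (simp add: Y_def fps_nth_exp_times_bessel[OF assms] mult_ac)
qed

section \<open>Integrating a power series against a complex power\<close>

text \<open>
  If \<open>u\<^sup>w\<close> has a limit \<open>L\<close> as \<open>u\<close> decreases to \<open>0\<close>, then replacing \<open>u\<close> by \<open>c u\<close> does not change the limit, so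
  \<open>c\<^sup>w L = L\<close> for every \<open>c > 0\<close>. As \<open>w\<close> is nonzero, some \<open>c\<close> has \<open>c\<^sup>w \<noteq> 1\<close>. This covers the three
  possible behaviours at once: decay, growth and, for purely imaginary \<open>w\<close>, oscillation.
\<close>
lemma tendsto_powr_at_right_0_imp_0:
  assumes "w \<noteq> 0" and lim: "((\<lambda>u. of_real u powr w) \<longlongrightarrow> L) (at_right (0 :: real))"
  shows "L = (0 :: complex)"
proof -
  \<comment> \<open>Then \<open>c\<^sup>w = exp (w / |w|)\<close>, and \<open>w / |w|\<close> has modulus \<open>1\<close>, which is smaller than \<open>2 \<pi>\<close>.\<close>
  define c where "c = exp (1 / norm w)"
  have "c > 0" by (simp add: c_def)
  have "filterlim (\<lambda>u. c * u) (at_right 0) (at_right (0 :: real))"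
    using filterlim_times_pos[of "\<lambda>u. u" 0 "at_right 0" c] \<open>c > 0\<close> by (simp add: filterlim_ident)
  from filterlim_compose[OF lim this]
  have "((\<lambda>u. of_real (c * u) powr w) \<longlongrightarrow> L) (at_right (0 :: real))" .
  moreover have "of_real (c * u) powr w = of_real c powr w * (of_real u powr w :: complex)" if "u > 0" for u
    using that \<open>c > 0\<close> by (simp add: powr_times_real)
  then have "\<forall>\<^sub>F u in at_right 0. of_real (c * u) powr w = of_real c powr w * (of_real u powr w :: complex)"
    using eventually_at_right_less[of "0 :: real"] by (auto elim: eventually_mono)
  ultimately have "((\<lambda>u. of_real c powr w * of_real u powr w) \<longlongrightarrow> L) (at_right (0 :: real))"
    by (rule Lim_transform_eventually)
  moreover have "((\<lambda>u. of_real c powr w * of_real u powr w) \<longlongrightarrow> of_real c powr w * L) (at_right (0 :: real))"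
    by (intro tendsto_intros lim)
  ultimately have "of_real c powr w * L = L"
    by (blast intro: tendsto_unique[OF trivial_limit_at_right_real])
  moreover have "of_real c powr w \<noteq> (1 :: complex)"
  proof
    assume "of_real c powr w = (1 :: complex)"
    then have "exp (w * of_real (1 / norm w)) = 1"
      using \<open>c > 0\<close> by (simp add: powr_def Ln_of_real c_def)
    then obtain n :: int where re: "Re (w * of_real (1 / norm w)) = 0" and n: "Im (w * of_real (1 / norm w)) = of_int (2 * n) * pi"
      unfolding exp_eq_1 by blast
    have "norm (w * of_real (1 / norm w)) = 1"
      using \<open>w \<noteq> 0\<close> by (simp add: norm_mult norm_divide)
    then have "\<bar>of_int (2 * n) * pi\<bar> = 1"
      using re n by (simp add: cmod_eq_Im)
    then have eq: "\<bar>of_int n\<bar> * (2 * pi) = 1"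
      by (simp add: abs_mult)
    then have "\<bar>n\<bar> \<ge> 1" by (cases "n = 0") auto
    then have "(1 :: real) \<le> \<bar>of_int n\<bar>"
      by (metis of_int_1_le_iff of_int_abs)
    then have "1 * (2 * pi) \<le> \<bar>of_int n\<bar> * (2 * pi)"
      by (intro mult_right_mono) auto
    then show False using eq pi_gt3 by simp
  qed
  ultimately show ?thesis by simp
qed

text \<open>
  Existence of the integral takes the place of a condition on the real part of \<open>w\<close>. On the half-open interval
  \<open>(0, 1]\<close> the integrand has the antiderivative \<open>u\<^sup>w S(u)\<close>, where \<open>S\<close> is the power series with coefficients
  \<open>F\<^sub>n / (n + w)\<close>. Integrability forces \<open>\<epsilon>\<^sup>w S(\<epsilon>) = S(1) - \<integral>\<^sub>\<epsilon>\<^sup>1\<close> (the integral of the same integrand) to converge as \<open>\<epsilon>\<close> tends to \<open>0\<close>. Because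
  \<open>S(0) = F\<^sub>0 / w\<close> is nonzero, \<open>\<epsilon>\<^sup>w\<close> then converges as well, necessarily to \<open>0\<close>, and hence the integral
  is \<open>S(1)\<close>.
\<close>
lemma sums_integral_powr_times_power_series:
  fixes F :: "complex fps"
  assumes radius: "fps_conv_radius F = \<infinity>"
    and "fps_nth F 0 \<noteq> 0"
    and w: "w \<notin> \<int>\<^sub>\<le>\<^sub>0"
    and int: "((\<lambda>u :: real. of_real u powr (w - 1) * eval_fps F (of_real u)) has_integral I) {0..1}"
  shows "(\<lambda>n. fps_nth F n / (of_nat n + w)) sums I"
proof -
  define S where "S = Abs_fps (\<lambda>n. fps_nth F n / (of_nat n + w))"
  have nz: "of_nat n + w \<noteq> 0" for n
    using w plus_of_nat_eq_0_imp[of w n] by (auto simp: add.commute)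
  have "w \<noteq> 0" using nz[of 0] by simp
  have rS: "fps_conv_radius S = \<infinity>"
    unfolding fps_conv_radius_def
  proof (rule conv_radius_inftyI'')
    fix z :: complex
    \<comment> \<open>From index \<open>N\<close> on the denominators have modulus at least \<open>1\<close>, so \<open>F\<close> dominates \<open>S\<close>.\<close>
    obtain N where N: "real N \<ge> 1 + norm w"
      using real_arch_simple by blast
    have "summable (\<lambda>n. norm (fps_nth F n * z ^ n))"
      by (rule norm_summable_fps) (simp add: radius)
    then show "summable (\<lambda>n. fps_nth S n * z ^ n)"
    proof (rule summable_comparison_test'[of _ N])
      fix n assume "n \<ge> N"
      then have "1 \<le> norm (of_nat n + w)"
        using N norm_diff_ineq[of "of_nat n" w] by simp
      then have "norm (fps_nth F n) / norm (of_nat n + w) \<le> norm (fps_nth F n) / 1"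
        by (intro divide_left_mono) (use nz[of n] in auto)
      then have "norm (fps_nth F n) / norm (of_nat n + w) * norm (z ^ n) \<le> norm (fps_nth F n) * norm (z ^ n)"
        by (intro mult_right_mono) simp_all
      then show "norm (fps_nth S n * z ^ n) \<le> norm (fps_nth F n * z ^ n)"
        by (simp add: S_def norm_mult norm_divide)
    qed
  qed
  have rS': "fps_conv_radius (fps_deriv S) = \<infinity>"
    using fps_conv_radius_deriv[of S] rS by simp
  \<comment> \<open>The coefficient form of \<open>(u\<^sup>w S(u))' = u\<^bsup>w-1\<^esup> F(u)\<close>.\<close>
  have ode: "fps_const w * S + fps_X * fps_deriv S = F"
  proof (rule fps_ext)
    fix n
    have "fps_nth (fps_const w * S + fps_X * fps_deriv S) n = (of_nat n + w) * fps_nth S n"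
      by (cases n) (simp_all add: algebra_simps)
    then show "fps_nth (fps_const w * S + fps_X * fps_deriv S) n = fps_nth F n"
      using nz[of n] by (simp add: S_def)
  qed
  have eval: "w * eval_fps S z + z * eval_fps (fps_deriv S) z = eval_fps F z" for z
    by (subst ode[symmetric], subst eval_fps_add)
       (simp_all add: eval_fps_mult rS rS' fps_conv_radius_cmult_left \<open>w \<noteq> 0\<close>
          less_le_trans[OF _ fps_conv_radius_mult])
  define f where "f = (\<lambda>u :: real. of_real u powr (w - 1) * eval_fps F (of_real u))"
  define H where "H = (\<lambda>z. z powr w * eval_fps S z)"
  have deriv: "((\<lambda>u. H (of_real u)) has_vector_derivative f u) (at u within A)" if "u > 0" for u :: real and A
  proof -
    have "of_real u \<notin> \<real>\<^sub>\<le>\<^sub>0" using that by simp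
    then have "(H has_field_derivative of_real u powr w * eval_fps (fps_deriv S) (of_real u)
        + w * of_real u powr (w - 1) * eval_fps S (of_real u)) (at (of_real u))"
      unfolding H_def using rS
      by (auto intro!: derivative_eq_intros has_field_derivative_eval_fps)
    moreover have "of_real u powr w = of_real u powr (w - 1) * (of_real u :: complex)"
      using that by (simp add: powr_diff)
    ultimately have "(H has_field_derivative f u) (at (of_real u))"
      unfolding f_def eval[symmetric] by (simp add: algebra_simps)
    then show ?thesis by (rule has_vector_derivative_real_field)
  qed
  have f: "f integrable_on {0..1}" "integral {0..1} f = I"
    using int by (auto simp: f_def has_integral_integrable integral_unique)
  have tail: "integral {e..1} f = eval_fps S 1 - H (of_real e)" if "0 < e" "e < 1" for e
  proof -
    have "(f has_integral H (of_real 1) - H (of_real e)) {e..1}"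
      by (intro fundamental_theorem_of_calculus) (use that in \<open>auto intro!: deriv\<close>)
    then show ?thesis by (simp add: integral_unique H_def)
  qed
  have "((\<lambda>e. integral {e..1} f) \<longlongrightarrow> I) (at 0 within {0..1})"
    using indefinite_integral_continuous_1'[OF f(1)] f(2) by (auto simp: continuous_on_def)
  then have "((\<lambda>e. integral {e..1} f) \<longlongrightarrow> I) (at_right 0)"
    by (simp add: at_within_Icc_at_right)
  moreover have ev: "\<forall>\<^sub>F e in at_right (0 :: real). 0 < e \<and> e < 1"
    by (auto simp: eventually_at_right_field intro!: exI[of _ 1])
  then have "\<forall>\<^sub>F e in at_right (0 :: real). integral {e..1} f = eval_fps S 1 - H (of_real e)"
    by eventually_elim (use tail in auto)
  ultimately have "((\<lambda>e. eval_fps S 1 - H (of_real e)) \<longlongrightarrow> I) (at_right 0)"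
    by (rule Lim_transform_eventually)
  from tendsto_diff[OF tendsto_const[of "eval_fps S 1"] this]
  have H: "((\<lambda>e. H (of_real e)) \<longlongrightarrow> eval_fps S 1 - I) (at_right (0 :: real))" by simp
  have "isCont (eval_fps S) 0"
    by (rule continuous_eval_fps) (simp add: rS)
  then have S0: "((\<lambda>e. eval_fps S (of_real e)) \<longlongrightarrow> fps_nth S 0) (at_right (0 :: real))"
    using isCont_tendsto_compose[of 0 "eval_fps S" of_real "at_right (0::real)"]
    by (simp add: eval_fps_at_0 tendsto_of_real_iff[of _ 0, simplified] filterlim_ident tendsto_ident_at)
  have "fps_nth S 0 \<noteq> 0"
    using assms(2) \<open>w \<noteq> 0\<close> by (simp add: S_def)
  note quot = tendsto_divide[OF H S0 this]
  moreover have "\<forall>\<^sub>F e in at_right (0 :: real). H (of_real e) / eval_fps S (of_real e) = of_real e powr w"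
    using tendsto_imp_eventually_ne[OF S0 \<open>fps_nth S 0 \<noteq> 0\<close>] by eventually_elim (simp add: H_def)
  ultimately have "((\<lambda>e. of_real e powr w) \<longlongrightarrow> (eval_fps S 1 - I) / fps_nth S 0) (at_right (0 :: real))"
    by (rule Lim_transform_eventually)
  then have "(eval_fps S 1 - I) / fps_nth S 0 = 0"
    by (rule tendsto_powr_at_right_0_imp_0[OF \<open>w \<noteq> 0\<close>])
  then have "eval_fps S 1 = I"
    using \<open>fps_nth S 0 \<noteq> 0\<close> by simp
  then show ?thesis
    using sums_eval_fps[of 1 S] rS by (simp add: S_def)
qed

section \<open>The Gegenbauer series as an integral\<close>

theorem theorem4p91:
  fixes p x t :: complex
  defines "f \<equiv> \<lambda>s. 2 powr p * s powr (2 * p) * t powr (- 2 * p - 1) * Gamma (p + 1) * exp (s * x)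
                    * Bessel_J_entire p (s * csqrt (1 - x\<^sup>2)) / Gamma (2 * p + 1)"
  assumes "x \<noteq> 1" and "x \<noteq> - 1" and "t \<noteq> 0"
    and "2 * p + 1 \<notin> \<int>\<^sub>\<le>\<^sub>0"
    and "f contour_integrable_on linepath 0 t"
  shows "(\<lambda>n. t ^ n * gegenbauer n (p + 1 / 2) x / complex_fact (of_nat n + 2 * p + 1))
           sums contour_integral (linepath 0 t) f"
proof -
  define w where "w = 2 * p + 1"
  define I where "I = contour_integral (linepath 0 t) f"
  have w: "w \<notin> \<int>\<^sub>\<le>\<^sub>0"
    using assms(5) by (simp add: w_def)
  have G: "Gamma w \<noteq> 0"
    using w by (simp add: Gamma_eq_zero_iff)
  \<comment> \<open>On the segment put \<open>s = t u\<close> with \<open>u\<close> in \<open>[0, 1]\<close>, so that the factor \<open>t\<^sup>n\<close> goes into the coefficients.\<close>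
  define F where "F = Abs_fps (\<lambda>n. gegenbauer n (p + 1 / 2) x / pochhammer w n * t ^ n)"
  have F: "(\<lambda>n. fps_nth F n * u ^ n) sums
      (2 powr p * Gamma (p + 1) * exp (t * u * x) * Bessel_J_entire p (t * u * csqrt (1 - x\<^sup>2)))" for u
    using gegenbauer_bessel_generating_function[OF assms(5), of x "t * u"]
    by (simp add: F_def w_def power_mult_distrib mult.assoc)
  have evalF: "eval_fps F u =
      2 powr p * Gamma (p + 1) * exp (t * u * x) * Bessel_J_entire p (t * u * csqrt (1 - x\<^sup>2))" for u
    using F[of u] by (simp add: eval_fps_def sums_iff)
  have radius: "fps_conv_radius F = \<infinity>"
    unfolding fps_conv_radius_def using F by (intro conv_radius_inftyI'') (auto simp: sums_iff)
  \<comment> \<open>The powers of \<open>t\<close> cancel, since \<open>(t u)\<^bsup>2p\<^esup> = t\<^bsup>2p\<^esup> u\<^bsup>2p\<^esup>\<close> for principal values when \<open>u\<close> is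
    nonnegative. At \<open>u = 0\<close> both sides vanish because \<open>0 powr a = 0\<close>.\<close>
  have integrand: "Gamma w * (f (linepath 0 t u) * (t - 0)) = of_real u powr (w - 1) * eval_fps F (of_real u)"
    if "u \<in> {0..1}" for u :: real
  proof -
    have "t powr (2 * p) * t powr (- 2 * p - 1) * t = 1"
      using \<open>t \<noteq> 0\<close> by (simp add: powr_add[symmetric] powr_minus)
    moreover have "linepath 0 t u = of_real u * t"
      by (simp add: linepath_def scaleR_conv_of_real)
    moreover have "(of_real u * t) powr (2 * p) = of_real u powr (2 * p) * t powr (2 * p)"
      using that by (intro powr_times_real_left) auto
    ultimately have "Gamma w * (f (linepath 0 t u) * (t - 0)) =
        of_real u powr (2 * p) * (t powr (2 * p) * t powr (- 2 * p - 1) * t) * eval_fps F (of_real u)"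
      using G unfolding f_def evalF w_def[symmetric] by (simp add: mult_ac)
    also have "\<dots> = of_real u powr (w - 1) * eval_fps F (of_real u)"
      unfolding \<open>t powr (2 * p) * t powr (- 2 * p - 1) * t = 1\<close> by (simp add: w_def)
    finally show ?thesis .
  qed
  have "(f has_contour_integral I) (linepath 0 t)"
    unfolding I_def using assms(6) by (rule has_contour_integral_integral)
  then have "((\<lambda>u. Gamma w * (f (linepath 0 t u) * (t - 0))) has_integral Gamma w * I) {0..1}"
    unfolding has_contour_integral_linepath by (rule has_integral_mult_right)
  then have "((\<lambda>u. of_real u powr (w - 1) * eval_fps F (of_real u)) has_integral Gamma w * I) {0..1}"
    by (rule has_integral_eq[rotated]) (rule integrand)
  then have "(\<lambda>n. fps_nth F n / (of_nat n + w)) sums (Gamma w * I)"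
    by (intro sums_integral_powr_times_power_series radius w) (simp_all add: F_def)
  then have "(\<lambda>n. fps_nth F n / (of_nat n + w) / Gamma w) sums (Gamma w * I / Gamma w)"
    by (rule sums_divide)
  also have "Gamma w * I / Gamma w = I"
    using G by simp
  also have "(\<lambda>n. fps_nth F n / (of_nat n + w) / Gamma w) =
      (\<lambda>n. t ^ n * gegenbauer n (p + 1 / 2) x / complex_fact (of_nat n + 2 * p + 1))"
  proof
    fix n
    have "pochhammer w (Suc n) = Gamma (w + of_nat (Suc n)) / Gamma w"
      by (rule pochhammer_Gamma[OF w])
    then have "complex_fact (of_nat n + 2 * p + 1) = pochhammer w n * (of_nat n + w) * Gamma w"
      using G by (simp add: complex_fact_def w_def pochhammer_Suc field_simps)
    then show "fps_nth F n / (of_nat n + w) / Gamma w =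
        t ^ n * gegenbauer n (p + 1 / 2) x / complex_fact (of_nat n + 2 * p + 1)"
      by (simp add: F_def mult_ac)
  qed
  finally show ?thesis
    by (simp add: I_def)
qed

end
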